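(* Let $k\geq 3$ and let $a,b,c$ be integers with $1<a<b<c$ and $a^k<b<c$. Then $\{a^k,b,c\}$ is not a $k$-th power Diophantine triple; that is, it is not the case that each of $a^k b+1$, $a^k c+1$ and $bc+1$ is a perfect $k$-th power of an integer.
   Context: For an integer $k\geq 3$, a set of positive integers $\{a_1,\dots,a_m\}$ is called a $k$-th power Diophantine $m$-tuple if $a_ia_j+1$ is a perfect $k$-th power (of an integer) for all $1\leq i<j\leq m$. *)

theory Defs
  imports Main
begin

definition is_kth_power :: "nat \<Rightarrow> int \<Rightarrow> bool" where
  "is_kth_power k n \<longleftrightarrow> (\<exists>x::int. n = x ^ k)"

end

theory Submission
  imports Defs "HOL-Analysis.Generalised_Binomial_Theorem" "HOL-Number_Theory.Cong"
begin

text \<open>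
  Write \<open>a ^ k * b + 1 = x ^ k\<close>, \<open>a ^ k * c + 1 = y ^ k\<close>, \<open>b * c + 1 = z ^ k\<close> and put
  \<open>N = x ^ k\<close>, \<open>X = a\<^sup>2 * z\<close>. Then \<open>X ^ k = (N - 1) * (y ^ k - 1) + a ^ (2 * k)\<close>, so
  \<open>x * y / X\<close> is extremely close to \<open>\<theta> = (N / (N - 1)) powr (1 / k)\<close>: one has
  \<open>0 < x * y - X * \<theta> \<le> x / (k * y ^ (k - 1))\<close>, where the left inequality uses \<open>a ^ k < b\<close>.

  The diagonal Pade approximants \<open>P\<^sub>n\<close>, \<open>Q\<^sub>n\<close> satisfy
  \<open>0 \<le> P\<^sub>n * \<theta> - Q\<^sub>n \<le> 1 / (k * 4 ^ n * (N - 1) ^ (n + 1))\<close> and become integers after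
  multiplication by \<open>k ^ (2 * n - 1)\<close>. Hence
  \<open>k ^ (2 * n - 1) * (P\<^sub>n * x * y - Q\<^sub>n * X)\<close>
  is a positive integer, thus at least \<open>1\<close>. If \<open>y\<close> is large enough for the error of
  \<open>x * y / X\<close> to contribute less than \<open>1 / 2\<close>, the remainder term must contribute the rest,
  which gives a lower bound for \<open>y\<close> that is sufficient for the same argument with \<open>n + 1\<close>.
  So \<open>y\<close> exceeds every bound.
\<close>

section \<open>Denominators of binomial coefficients\<close>

text \<open>Legendre's recursion: among \<open>1, ..., i\<close> there are \<open>i div p\<close>
  multiples of \<open>p\<close>, and dividing each of them by \<open>p\<close> leaves the factors of
  \<open>fact (i div p)\<close>.\<close>

lemma multiplicity_fact_rec:
  fixes p :: nat
  assumes p: "prime p"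
  shows "multiplicity p (fact i :: nat) = i div p + multiplicity p (fact (i div p) :: nat)"
proof (induction i)
  case 0
  then show ?case by simp
next
  case (Suc i)
  have p0: "p > 0" using p prime_gt_0_nat by blast
  have step: "multiplicity p (fact (Suc m) :: nat) = multiplicity p (Suc m) + multiplicity p (fact m :: nat)" for m
    using p by (simp add: prime_elem_multiplicity_mult_distrib del: mult_Suc)
  show ?case
  proof (cases "p dvd Suc i")
    case True
    then obtain q where q: "Suc i = p * q" by blast
    then obtain q' where q': "q = Suc q'" by (cases q) auto
    have div: "Suc i div p = Suc q'" "i div p = q'"
      using q q' p0 div_nat_eqI[of p q' i] by (auto simp: algebra_simps)
    have "multiplicity p (Suc i) = Suc (multiplicity p (Suc q'))"
      unfolding q q' using p p0 by (subst multiplicity_times_same) auto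
    then show ?thesis
      using Suc unfolding step div by simp
  next
    case False
    then have "multiplicity p (Suc i) = 0" "Suc i div p = i div p"
      by (auto simp: not_dvd_imp_multiplicity_0 div_Suc dvd_eq_mod_eq_0)
    then show ?thesis using Suc unfolding step by simp
  qed
qed

text \<open>With \<open>q = i div p\<close> the recursion gives less than
  \<open>2 * q \<le> p * q \<le> i\<close>. The strict inequality is what later allows the exponent
  \<open>i - 1\<close> instead of \<open>i\<close>.\<close>

lemma multiplicity_fact_less:
  fixes p :: nat
  assumes p: "prime p" and "i > 0"
  shows "multiplicity p (fact i :: nat) < i"
  using \<open>i > 0\<close>
proof (induction i rule: less_induct)
  case (less i)
  have p2: "p \<ge> 2" using p prime_ge_2_nat by blast
  show ?case
  proof (cases "i div p = 0")
    case True
    then show ?thesis using less.prems multiplicity_fact_rec[OF p, of i] by simp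
  next
    case False
    have "multiplicity p (fact (i div p) :: nat) < i div p"
      using False less.prems p2 by (intro less.IH) auto
    then have "multiplicity p (fact i :: nat) < 2 * (i div p)"
      using multiplicity_fact_rec[OF p, of i] by simp
    also have "\<dots> \<le> p * (i div p)" using p2 by simp
    also have "\<dots> \<le> i" by simp
    finally show ?thesis .
  qed
qed

lemma fact_dvd_prod_consecutive:
  "fact i dvd (\<Prod>l<i. int w - int l)"
proof -
  have "real_of_int (\<Prod>l<i. int w - int l) = real_of_int (fact i * int (w choose i))"
    using gbinomial_mult_fact[of i "real w"] by (simp add: binomial_gbinomial atLeast0LessThan)
  then have "(\<Prod>l<i. int w - int l) = fact i * int (w choose i)"
    by (simp only: of_int_eq_iff)
  then show ?thesis by simp
qed

text \<open>Modulo \<open>q\<close> the number \<open>k\<close> has an inverse \<open>u\<close>, and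
  \<open>k * (s - l) - 1\<close> becomes \<open>k * ((s - u) - l)\<close>. Up to a power of
  \<open>k\<close> the product is then one of consecutive integers, which \<open>fact i\<close>
  divides.\<close>

lemma coprime_dvd_fact_imp_dvd_prod_progression:
  fixes q k s :: int
  assumes "coprime k q" "q dvd fact i" "q > 0"
  shows "q dvd (\<Prod>l<i. k * (s - int l) - 1)"
proof -
  obtain u where u: "[k * u = 1] (mod q)"
    using cong_solve_coprime_int[OF assms(1)] by blast
  define w where "w = nat ((s - u) mod q)"
  have w: "[int w = s - u] (mod q)"
    using assms(3) by (simp add: w_def cong_def)
  have "[k * (s - int l) - 1 = k * (int w - int l)] (mod q)" for l
  proof -
    have "[k * (s - int l) - 1 = k * (s - int l) - k * u] (mod q)"
      using u by (intro cong_diff cong_refl) (simp add: cong_sym)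
    also have "k * (s - int l) - k * u = k * ((s - u) - int l)"
      by (simp add: algebra_simps)
    also have "[\<dots> = k * (int w - int l)] (mod q)"
      using w by (intro cong_mult cong_diff cong_refl) (simp add: cong_sym)
    finally show ?thesis .
  qed
  then have "[(\<Prod>l<i. k * (s - int l) - 1) = (\<Prod>l<i. k * (int w - int l))] (mod q)"
    by (rule cong_prod)
  moreover have "q dvd (\<Prod>l<i. k * (int w - int l))"
    unfolding prod.distrib using assms(2) fact_dvd_prod_consecutive[of i w] by (meson dvd_mult dvd_trans)
  ultimately show ?thesis
    using cong_dvd_iff by blast
qed

text \<open>Prime by prime: a prime dividing \<open>k\<close> occurs at most \<open>i - 1\<close>
  times in \<open>fact i\<close> and is absorbed by \<open>k ^ (i - 1)\<close>; powers of any other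
  prime are coprime to \<open>k\<close> and divide the product.\<close>

lemma fact_dvd_power_times_prod_progression:
  fixes k s :: int
  assumes "k > 0" "i > 0"
  shows "fact i dvd k ^ (i - 1) * (\<Prod>l<i. k * (s - int l) - 1)"
proof (cases "(\<Prod>l<i. k * (s - int l) - 1) = 0")
  case False
  define R where "R = (\<Prod>l<i. k * (s - int l) - 1)"
  show ?thesis
    unfolding R_def[symmetric]
  proof (rule multiplicity_le_imp_dvd)
    fix p :: int
    assume p: "prime p"
    define m where "m = multiplicity p (fact i :: int)"
    have pm: "p ^ m dvd fact i"
      by (simp add: m_def multiplicity_dvd)
    obtain p' where p': "p = int p'" "prime p'"
      using p by (metis prime_int_nat_transfer prime_ge_0_int nat_0_le)
    have "m < i"
    proof -
      have "int (p' ^ m) dvd int (fact i)"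
        using pm p' by simp
      then have "p' ^ m dvd (fact i :: nat)"
        by (simp only: int_dvd_int_iff)
      then have "m \<le> multiplicity p' (fact i :: nat)"
        using p' by (intro multiplicity_geI) (auto simp: finite_divisor_powers)
      then show ?thesis
        using multiplicity_fact_less[OF p'(2) \<open>i > 0\<close>] by simp
    qed
    have "p ^ m dvd k ^ (i - 1) * R"
    proof (cases "p dvd k")
      case True
      then have "p ^ m dvd k ^ m" by (rule dvd_power_same)
      also have "\<dots> dvd k ^ (i - 1)"
        using \<open>m < i\<close> by (intro le_imp_power_dvd) simp
      finally show ?thesis by simp
    next
      case False
      then have "coprime k (p ^ m)"
        using p prime_imp_coprime[of p k] by (simp add: coprime_commute)
      then have "p ^ m dvd R"
        unfolding R_def using pm p by (intro coprime_dvd_fact_imp_dvd_prod_progression) (auto simp: prime_gt_0_int)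
      then show ?thesis by simp
    qed
    moreover have "k ^ (i - 1) * R \<noteq> 0"
      using False assms by (simp add: R_def)
    ultimately show "multiplicity p (fact i) \<le> multiplicity p (k ^ (i - 1) * R)"
      using p unfolding m_def by (intro multiplicity_geI) auto
  qed simp
next
  case True
  then show ?thesis by (simp only: mult_zero_right dvd_0_right)
qed

lemma gbinomial_denominator:
  fixes k n i :: nat
  assumes "k > 0" "i \<le> n"
  shows "real k ^ (2 * n - 1) * ((real n - 1 / real k) gchoose i) \<in> \<int>"
proof (cases "i = 0")
  case True
  then show ?thesis by simp
next
  case False
  define R where "R = (\<Prod>l<i. int k * (int n - int l) - 1)"
  obtain t where t: "int k ^ (i - 1) * R = fact i * t"
    using fact_dvd_power_times_prod_progression[of "int k" i "int n"] assms False
    unfolding R_def by (auto elim: dvdE)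
  have R: "real k ^ i * (\<Prod>l<i. real n - 1 / real k - real l) = real_of_int R"
  proof -
    have "real k ^ i * (\<Prod>l<i. real n - 1 / real k - real l) = (\<Prod>l<i. real k * (real n - 1 / real k - real l))"
      by (simp add: prod.distrib)
    also have "\<dots> = (\<Prod>l<i. real k * (real n - real l) - 1)"
      using assms by (intro prod.cong) (auto simp: algebra_simps)
    finally show ?thesis by (simp add: R_def)
  qed
  \<comment> \<open>The factor \<open>k ^ i\<close> clears the fractions \<open>1 / k\<close>,
    \<open>k ^ (i - 1)\<close> makes \<open>fact i\<close> divide, and the rest is surplus.\<close>
  have "2 * n - 1 = (2 * n - 2 * i) + (i - 1) + i"
    using assms False by simp
  then have "real k ^ (2 * n - 1) = real k ^ (2 * n - 2 * i) * real k ^ (i - 1) * real k ^ i"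
    by (simp only: power_add)
  then have "real k ^ (2 * n - 1) * ((real n - 1 / real k) gchoose i) * fact i =
      real k ^ (2 * n - 2 * i) * real k ^ (i - 1) * (real k ^ i * (\<Prod>l<i. real n - 1 / real k - real l))"
    unfolding mult.assoc gbinomial_mult_fact' by (simp add: atLeast0LessThan)
  also have "\<dots> = real k ^ (2 * n - 2 * i) * real_of_int (int k ^ (i - 1) * R)"
    unfolding R by simp
  also have "\<dots> = real_of_int (int k ^ (2 * n - 2 * i) * t) * fact i"
    unfolding t by simp
  finally have "real k ^ (2 * n - 1) * ((real n - 1 / real k) gchoose i) = real_of_int (int k ^ (2 * n - 2 * i) * t)"
    by simp
  then show ?thesis by (metis Ints_of_int)
qed

section \<open>Pade approximants to powers of N / (N - 1)\<close>

text \<open>Trinomial revision turns \<open>(a gchoose j) * (j choose i)\<close> into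
  \<open>(a gchoose i) * ((a - i) gchoose (j - i))\<close>, so this is the binomial series of
  exponent \<open>a - i\<close> shifted by \<open>i\<close>.\<close>

lemma binomial_moment_sums:
  fixes a z :: real
  assumes "\<bar>z\<bar> < 1"
  shows "(\<lambda>j. (a gchoose j) * real (j choose i) * z ^ j) sums
           ((a gchoose i) * z ^ i * (1 + z) powr (a - real i))"
proof -
  have shift: "(a gchoose (j + i)) * real ((j + i) choose i) * z ^ (j + i)
      = (a gchoose i) * z ^ i * ((a - real i gchoose j) * z ^ j)" for j
    using gbinomial_trinomial_revision[of i "j + i" a]
    by (simp add: binomial_gbinomial power_add)
  have "(\<lambda>j. (a gchoose i) * z ^ i * ((a - real i gchoose j) * z ^ j)) sums
          ((a gchoose i) * z ^ i * (1 + z) powr (a - real i))"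
    by (intro sums_mult gen_binomial_real assms)
  then have "(\<lambda>j. (a gchoose (j + i)) * real ((j + i) choose i) * z ^ (j + i)) sums
          ((a gchoose i) * z ^ i * (1 + z) powr (a - real i))"
    by (simp only: shift)
  then show ?thesis
    by (subst (asm) sums_zero_iff_shift) (auto simp: binomial_eq_0)
qed

text \<open>Negating the upper index of \<open>(2 * n - i) choose (n - i)\<close> gives upper index
  \<open>- (n + 1)\<close>, and the sum becomes a Vandermonde convolution. As a polynomial in
  \<open>j\<close> the result vanishes at \<open>n + 1, ..., 2 * n\<close>.\<close>

lemma alternating_binomial_convolution:
  "(\<Sum>i\<le>n. (-1) ^ i * real (j choose i) * real ((2 * n - i) choose n))
     = (-1) ^ n * ((real j - real n - 1) gchoose n)"
proof -
  have summand: "(-1) ^ i * real (j choose i) * real ((2 * n - i) choose n)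
      = (-1) ^ n * ((real j gchoose i) * ((- real (n + 1)) gchoose (n - i)))" if "i \<le> n" for i
  proof -
    have "(2 * n - i) choose n = (2 * n - i) choose (n - i)"
      using that by (subst binomial_symmetric) auto
    moreover have "(- real (n + 1)) gchoose (n - i) = (-1) ^ (n - i) * real ((2 * n - i) choose (n - i))"
      unfolding gbinomial_minus binomial_gbinomial using that by (simp add: of_nat_diff algebra_simps)
    moreover have "(-1) ^ n = (-1 :: real) ^ i * (-1) ^ (n - i)"
      using that by (simp flip: power_add)
    ultimately show ?thesis
      by (simp add: binomial_gbinomial)
  qed
  have "(\<Sum>i\<le>n. (-1) ^ i * real (j choose i) * real ((2 * n - i) choose n))
     = (-1) ^ n * (\<Sum>i\<le>n. (real j gchoose i) * ((- real (n + 1)) gchoose (n - i)))"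
    by (simp add: summand sum_distrib_left)
  also have "(\<Sum>i\<le>n. (real j gchoose i) * ((- real (n + 1)) gchoose (n - i)))
     = (real j - real n - 1) gchoose n"
    using gbinomial_Vandermonde[of "real j" "- real (n + 1)" n]
    by (simp add: atLeast0AtMost algebra_simps)
  finally show ?thesis .
qed

text \<open>
  Diagonal Pade approximants: with \<open>z = 1 / N\<close>, \<open>pade_den / pade_num\<close> approximates
  \<open>(1 - z) powr -\<nu>\<close> to order \<open>z ^ (2 * n + 1)\<close>. Both are values of the form
  \<open>\<Sum>i. ((n - \<nu>) gchoose i) * ((2 * n - i) choose n) * u ^ (n - i) * v ^ i\<close>,
  at \<open>(N - 1, 1)\<close> and \<open>(N, -1)\<close>.
\<close>

definition pade_num :: "nat \<Rightarrow> real \<Rightarrow> real \<Rightarrow> real" where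
  "pade_num n \<nu> N = (\<Sum>i\<le>n. ((real n - \<nu>) gchoose i) * real ((2 * n - i) choose n) * (N - 1) ^ (n - i))"

definition pade_den :: "nat \<Rightarrow> real \<Rightarrow> real \<Rightarrow> real" where
  "pade_den n \<nu> N = (\<Sum>i\<le>n. (-1) ^ i * ((real n - \<nu>) gchoose i) * real ((2 * n - i) choose n) * N ^ (n - i))"

text \<open>The moment series at \<open>-1 / N\<close> are combined with weights
  \<open>(-1) ^ i * ((2 * n - i) choose n)\<close>. Their closed forms add up to the
  \<open>pade_num\<close> term, while the convolution identity gives the coefficients of the
  combined series.\<close>

lemma pade_series:
  fixes N \<nu> :: real
  assumes N: "N > 1"
  shows "(\<lambda>r. N ^ n * (-1) ^ (n + 1 + r) * ((real n - \<nu>) gchoose (2 * n + 1 + r))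
              * real ((n + r) choose n) * (1 / N) ^ (2 * n + 1 + r))
         sums (pade_num n \<nu> N * (N / (N - 1)) powr \<nu> - pade_den n \<nu> N)"
proof -
  define a where "a = real n - \<nu>"
  define z where "z = 1 / N"
  have z: "0 < z" "z < 1" "1 - z = (N - 1) / N"
    using N by (auto simp: z_def field_simps)
  \<comment> \<open>The polynomial factor of \<open>f j\<close> equals \<open>(2 * n - j) choose n\<close> for \<open>j \<le> n\<close> and vanishes for
    \<open>n < j \<le> 2 * n\<close>: the series starts with \<open>pade_den\<close> and then has a gap of length \<open>n\<close>.\<close>
  define f where "f j = (a gchoose j) * ((-1) ^ n * ((real j - real n - 1) gchoose n)) * (-z) ^ j" for j
  have "(\<lambda>j. \<Sum>i\<le>n. (-1) ^ i * real ((2 * n - i) choose n) * ((a gchoose j) * real (j choose i) * (-z) ^ j)) sums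
     (\<Sum>i\<le>n. (-1) ^ i * real ((2 * n - i) choose n) * ((a gchoose i) * (-z) ^ i * (1 + - z) powr (a - real i)))"
    using z by (intro sums_sum sums_mult binomial_moment_sums) auto
  also have "(\<lambda>j. \<Sum>i\<le>n. (-1) ^ i * real ((2 * n - i) choose n) * ((a gchoose j) * real (j choose i) * (-z) ^ j)) = f"
    unfolding f_def alternating_binomial_convolution[symmetric]
    by (auto simp: sum_distrib_left sum_distrib_right fun_eq_iff mult_ac intro!: sum.cong)
  finally have "(\<lambda>j. N ^ n * f j) sums (N ^ n * (\<Sum>i\<le>n. (-1) ^ i * real ((2 * n - i) choose n) * ((a gchoose i) * (-z) ^ i * (1 + - z) powr (a - real i))))"
    by (rule sums_mult)
  also have "N ^ n * (\<Sum>i\<le>n. (-1) ^ i * real ((2 * n - i) choose n) * ((a gchoose i) * (-z) ^ i * (1 + - z) powr (a - real i)))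
      = pade_num n \<nu> N * (N / (N - 1)) powr \<nu>"
    unfolding pade_num_def sum_distrib_left sum_distrib_right
  proof (rule sum.cong[OF refl], goal_cases)
    case (1 i)
    then have i: "i \<le> n" by simp
    have "(1 + - z) powr (a - real i) = (1 - z) powr (real (n - i)) * (1 - z) powr (- \<nu>)"
      using i by (simp add: powr_add[symmetric] a_def of_nat_diff algebra_simps)
    also have "(1 - z) powr (real (n - i)) = (1 - z) ^ (n - i)"
      using z by (simp add: powr_realpow)
    also have "(1 - z) powr (- \<nu>) = (N / (N - 1)) powr \<nu>"
      using N z by (simp add: powr_minus powr_divide)
    finally have pw: "(1 + - z) powr (a - real i) = (1 - z) ^ (n - i) * (N / (N - 1)) powr \<nu>" .
    have sg: "(-1) ^ i * (-z) ^ i = z ^ i"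
      by (simp flip: power_mult_distrib)
    have "N ^ n = N ^ i * N ^ (n - i)"
      using i by (simp flip: power_add)
    then have "N ^ n * (z ^ i * (1 - z) ^ (n - i)) = (N * z) ^ i * (N * (1 - z)) ^ (n - i)"
      by (simp add: power_mult_distrib)
    also have "\<dots> = (N - 1) ^ (n - i)"
      using N by (simp add: z_def algebra_simps)
    finally have "N ^ n * (z ^ i * (1 - z) ^ (n - i)) = (N - 1) ^ (n - i)" .
    moreover have "N ^ n * ((-1) ^ i * real ((2 * n - i) choose n) * ((a gchoose i) * (-z) ^ i * (1 + - z) powr (a - real i)))
        = (a gchoose i) * real ((2 * n - i) choose n) * (N ^ n * (((-1) ^ i * (-z) ^ i) * (1 - z) ^ (n - i)))
            * (N / (N - 1)) powr \<nu>"
      unfolding pw by (simp only: mult_ac)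
    ultimately show ?case
      unfolding sg a_def by simp
  qed
  finally have sums: "(\<lambda>j. N ^ n * f j) sums (pade_num n \<nu> N * (N / (N - 1)) powr \<nu>)" .
  have low: "N ^ n * f j = (-1) ^ j * (a gchoose j) * real ((2 * n - j) choose n) * N ^ (n - j)" if "j \<le> n" for j
  proof -
    have "(-1) ^ n * ((real j - real n - 1) gchoose n) = real ((2 * n - j) choose n)"
      using that by (subst gbinomial_negated_upper) (simp add: binomial_gbinomial of_nat_diff algebra_simps)
    moreover have "N ^ n = N ^ j * N ^ (n - j)"
      using that by (simp flip: power_add)
    moreover have "(-z) ^ j = (-1) ^ j * z ^ j"
      by (simp flip: power_mult_distrib)
    ultimately have "N ^ n * f j = (N ^ j * z ^ j) * ((-1) ^ j * (a gchoose j) * real ((2 * n - j) choose n) * N ^ (n - j))"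
      unfolding f_def by (simp only: mult_ac)
    moreover have "N ^ j * z ^ j = 1"
      using N by (simp add: z_def flip: power_mult_distrib)
    ultimately show ?thesis by simp
  qed
  have mid: "f j = 0" if "n < j" "j < 2 * n + 1" for j
  proof -
    have "real j - real n - 1 = real (j - n - 1)"
      using that by (simp add: of_nat_diff)
    then have "(real j - real n - 1) gchoose n = real ((j - n - 1) choose n)"
      by (simp only: binomial_gbinomial)
    then show ?thesis
      using that unfolding f_def by (simp add: binomial_eq_0)
  qed
  have "(\<Sum>j<2 * n + 1. N ^ n * f j) = (\<Sum>j\<le>n. N ^ n * f j)"
    by (rule sum.mono_neutral_right) (auto simp: mid)
  also have "\<dots> = pade_den n \<nu> N"
    unfolding pade_den_def a_def[symmetric] by (simp add: low)
  finally have "(\<lambda>r. N ^ n * f (r + (2 * n + 1))) sums (pade_num n \<nu> N * (N / (N - 1)) powr \<nu> - pade_den n \<nu> N)"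
    using sums_split_initial_segment[OF sums, of "2 * n + 1"] by simp
  moreover have "N ^ n * f (r + (2 * n + 1)) = N ^ n * (-1) ^ (n + 1 + r) * (a gchoose (2 * n + 1 + r))
              * real ((n + r) choose n) * z ^ (2 * n + 1 + r)" for r
  proof -
    have "real (r + (2 * n + 1)) - real n - 1 = real (n + r)" by simp
    moreover have "(-z) ^ (2 * n + 1 + r) = (-1) ^ (1 + r) * z ^ (2 * n + 1 + r)"
      by (simp add: power_add power_mult flip: power_mult_distrib)
    ultimately show ?thesis
      unfolding f_def by (simp add: binomial_gbinomial power_add add_ac)
  qed
  ultimately show ?thesis
    unfolding z_def a_def by simp
qed

text \<open>Passing from \<open>n\<close> to \<open>n + 1\<close> multiplies the signed coefficient
  by \<open>((n + 1)\<^sup>2 - \<nu>\<^sup>2) / ((2 * n + 2) * (2 * n + 3))\<close>, which lies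
  between \<open>0\<close> and \<open>1 / 4\<close>.\<close>

lemma gbinomial_middle_bounds:
  fixes \<nu> :: real
  assumes "0 \<le> \<nu>" "\<nu> \<le> 1"
  shows "0 \<le> (-1) ^ (n + 1) * ((real n - \<nu>) gchoose (2 * n + 1))
       \<and> (-1) ^ (n + 1) * ((real n - \<nu>) gchoose (2 * n + 1)) \<le> \<nu> / 4 ^ n"
proof (induction n)
  case 0
  then show ?case using assms by simp
next
  case (Suc n)
  define a where "a = real n - \<nu>"
  define g where "g = (-1) ^ (n + 1) * (a gchoose (2 * n + 1))"
  have up: "(a gchoose Suc m) = (a gchoose m) * (a - real m) / real (Suc m)" for m
    using gbinomial_mult_1[of a m] by (simp add: field_simps del: of_nat_Suc)
  have "(real (Suc n) - \<nu>) gchoose (2 * Suc n + 1) = (a + 1) gchoose Suc (Suc (2 * n + 1))"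
    by (simp add: a_def algebra_simps)
  also have "\<dots> = (a gchoose (2 * n + 1)) * ((a - real (2 * n + 1)) / real (2 * n + 2)) * ((a + 1) / real (2 * n + 3))"
    unfolding gbinomial_rec up by (simp add: add_ac)
  finally have "(-1) ^ (Suc n + 1) * ((real (Suc n) - \<nu>) gchoose (2 * Suc n + 1))
      = g * (((real n + 1 + \<nu>) / real (2 * n + 2)) * ((real n + 1 - \<nu>) / real (2 * n + 3)))"
    by (simp add: g_def a_def field_simps)
  also have "((real n + 1 + \<nu>) / real (2 * n + 2)) * ((real n + 1 - \<nu>) / real (2 * n + 3)) =
      ((real n + 1) ^ 2 - \<nu> ^ 2) / (real (2 * n + 2) * real (2 * n + 3))" (is "_ = ?q")
    by (simp add: field_simps power2_eq_square)
  finally have eq: "(-1) ^ (Suc n + 1) * ((real (Suc n) - \<nu>) gchoose (2 * Suc n + 1)) = g * ?q" .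
  have "\<nu> ^ 2 \<le> (real n + 1) ^ 2"
    using assms by (intro power_mono) auto
  then have q0: "0 \<le> ?q" by simp
  have "4 * ((real n + 1) ^ 2 - \<nu> ^ 2) \<le> 4 * (real n + 1) ^ 2"
    by simp
  also have "\<dots> \<le> real (2 * n + 2) * real (2 * n + 3)"
    by (simp add: power2_eq_square algebra_simps)
  finally have q1: "?q \<le> 1 / 4"
    by (simp add: divide_le_eq mult_ac)
  have g: "0 \<le> g" "g \<le> \<nu> / 4 ^ n"
    using Suc by (simp_all add: g_def a_def)
  have "g * ?q \<le> (\<nu> / 4 ^ n) * (1 / 4)"
    using g q0 q1 by (intro mult_mono) auto
  moreover have "0 \<le> g * ?q"
    using g q0 by (intro mult_nonneg_nonneg)
  ultimately show ?case
    unfolding eq by simp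
qed

text \<open>Consecutive coefficients have ratio
  \<open>- (n + 1 + r + \<nu>) / (2 * n + 2 + r)\<close>: the sign alternates, and the size does not
  grow because \<open>\<nu> \<le> 1\<close>.\<close>

lemma gbinomial_tail_bounds:
  fixes \<nu> :: real
  assumes "0 \<le> \<nu>" "\<nu> \<le> 1"
  shows "0 \<le> (-1) ^ (n + 1 + r) * ((real n - \<nu>) gchoose (2 * n + 1 + r))
       \<and> (-1) ^ (n + 1 + r) * ((real n - \<nu>) gchoose (2 * n + 1 + r)) \<le> \<nu> / 4 ^ n"
proof (induction r)
  case 0
  then show ?case using gbinomial_middle_bounds[OF assms, of n] by simp
next
  case (Suc r)
  define a where "a = real n - \<nu>"
  define g where "g = (-1) ^ (n + 1 + r) * (a gchoose (2 * n + 1 + r))"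
  have "(a gchoose Suc (2 * n + 1 + r)) = (a gchoose (2 * n + 1 + r)) * (a - real (2 * n + 1 + r)) / real (Suc (2 * n + 1 + r))"
    using gbinomial_mult_1[of a "2 * n + 1 + r"] by (simp add: field_simps del: of_nat_Suc)
  then have "(-1) ^ (n + 1 + Suc r) * (a gchoose (2 * n + 1 + Suc r)) =
      g * (- (a - real (2 * n + 1 + r)) / real (Suc (2 * n + 1 + r)))"
    by (simp add: g_def mult.assoc del: of_nat_Suc of_nat_add minus_diff_eq)
  also have "- (a - real (2 * n + 1 + r)) / real (Suc (2 * n + 1 + r)) =
      (real n + 1 + real r + \<nu>) / (2 * real n + 2 + real r)"
    by (simp add: a_def add_ac)
  finally have eq: "(-1) ^ (n + 1 + Suc r) * (a gchoose (2 * n + 1 + Suc r)) =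
      g * ((real n + 1 + real r + \<nu>) / (2 * real n + 2 + real r))" .
  have q: "0 \<le> (real n + 1 + real r + \<nu>) / (2 * real n + 2 + real r)"
      "(real n + 1 + real r + \<nu>) / (2 * real n + 2 + real r) \<le> 1"
    using assms by (auto simp: divide_le_eq)
  have g: "0 \<le> g" "g \<le> \<nu> / 4 ^ n"
    using Suc by (simp_all add: g_def a_def)
  have "g * ((real n + 1 + real r + \<nu>) / (2 * real n + 2 + real r)) \<le> (\<nu> / 4 ^ n) * 1"
    using g q by (intro mult_mono) auto
  with g q show ?case
    unfolding a_def[symmetric] eq by (metis mult_1_right mult_nonneg_nonneg)
qed

lemma pade_remainder:
  fixes N \<nu> :: real and n :: nat
  assumes N: "N > 1" and \<nu>: "0 \<le> \<nu>" "\<nu> \<le> 1"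
  defines "T \<equiv> pade_num n \<nu> N * (N / (N - 1)) powr \<nu> - pade_den n \<nu> N"
  shows "0 \<le> T" "T \<le> \<nu> / (4 ^ n * (N - 1) ^ (n + 1))"
proof -
  define z where "z = 1 / N"
  have z: "0 < z" "z < 1" "1 - z = (N - 1) / N"
    using N by (auto simp: z_def field_simps)
  define t where "t r = N ^ n * (-1) ^ (n + 1 + r) * ((real n - \<nu>) gchoose (2 * n + 1 + r))
              * real ((n + r) choose n) * z ^ (2 * n + 1 + r)" for r
  have t: "t sums T"
    unfolding t_def z_def T_def by (rule pade_series[OF N])
  note b = gbinomial_tail_bounds[OF \<nu>]
  have t_eq: "t r = ((-1) ^ (n + 1 + r) * ((real n - \<nu>) gchoose (2 * n + 1 + r)))
              * (N ^ n * real ((n + r) choose n) * z ^ (2 * n + 1 + r))" for r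
    by (simp add: t_def mult_ac)
  have t0: "0 \<le> t r" for r
    unfolding t_eq using b[of n r] N z by (intro mult_nonneg_nonneg[OF conjunct1]) auto
  then show "0 \<le> T"
    using sums_le[OF _ sums_zero t] by simp
  have t1: "t r \<le> \<nu> / 4 ^ n * N ^ n * z ^ (2 * n + 1) * (real ((n + r) choose n) * z ^ r)" for r
  proof -
    have "t r \<le> (\<nu> / 4 ^ n) * (N ^ n * real ((n + r) choose n) * z ^ (2 * n + 1 + r))"
      unfolding t_eq using b[of n r] N z by (intro mult_right_mono) auto
    then show ?thesis by (simp add: power_add mult_ac)
  qed
  \<comment> \<open>Once the coefficients are replaced by their common bound, a negative binomial
    series remains, with sum \<open>(1 - z) powr - (n + 1)\<close>.\<close>
  have "(\<lambda>r. (- real (n + 1) gchoose r) * (- z) ^ r) sums (1 + - z) powr (- real (n + 1))"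
    by (rule gen_binomial_real) (use z in auto)
  moreover have "(- real (n + 1) gchoose r) * (- z) ^ r = real ((n + r) choose n) * z ^ r" for r
  proof -
    have "- real (n + 1) gchoose r = (-1) ^ r * real ((n + r) choose r)"
      unfolding gbinomial_minus binomial_gbinomial by (simp add: algebra_simps)
    moreover have "(n + r) choose r = (n + r) choose n"
      by (subst binomial_symmetric) auto
    moreover have "(-1) ^ r * (- z) ^ r = z ^ r"
      by (simp flip: power_mult_distrib)
    moreover have "(-1) ^ r * real ((n + r) choose n) * (- z) ^ r = real ((n + r) choose n) * ((-1) ^ r * (- z) ^ r)"
      by (simp only: mult_ac)
    ultimately show ?thesis by simp
  qed
  ultimately have "(\<lambda>r. real ((n + r) choose n) * z ^ r) sums (1 - z) powr (- real (n + 1))"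
    by simp
  also have "(1 - z) powr (- real (n + 1)) = (N / (N - 1)) ^ (n + 1)"
    using N z by (simp add: powr_minus powr_realpow power_divide del: of_nat_add of_nat_Suc power_Suc)
  finally have "T \<le> \<nu> / 4 ^ n * N ^ n * z ^ (2 * n + 1) * (N / (N - 1)) ^ (n + 1)"
    by (intro sums_le[OF t1 t] sums_mult)
  also have "\<nu> / 4 ^ n * N ^ n * z ^ (2 * n + 1) * (N / (N - 1)) ^ (n + 1) = \<nu> / 4 ^ n * (1 / (N - 1) ^ (n + 1))"
  proof -
    have "N ^ n * z ^ (2 * n + 1) * N ^ (n + 1) = (N * z) ^ (2 * n + 1)"
      by (simp add: power_mult_distrib power_add mult_2)
    also have "\<dots> = 1" using N by (simp add: z_def)
    finally have "N ^ n * z ^ (2 * n + 1) * (N / (N - 1)) ^ (n + 1) = 1 / (N - 1) ^ (n + 1)"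
      by (simp add: power_divide)
    then show ?thesis by (simp only: mult.assoc)
  qed
  finally show "T \<le> \<nu> / (4 ^ n * (N - 1) ^ (n + 1))"
    by simp
qed

lemma gbinomial_le_binomial:
  fixes \<nu> :: real
  assumes "0 \<le> \<nu>" "\<nu> \<le> 1" "i \<le> n"
  shows "0 \<le> (real n - \<nu>) gchoose i" "((real n - \<nu>) gchoose i) \<le> real (n choose i)"
proof -
  show "0 \<le> (real n - \<nu>) gchoose i"
    unfolding gbinomial_prod_rev using assms by (auto intro!: divide_nonneg_pos prod_nonneg)
  show "((real n - \<nu>) gchoose i) \<le> real (n choose i)"
    unfolding gbinomial_prod_rev binomial_gbinomial using assms
    by (auto intro!: divide_right_mono prod_mono)
qed

text \<open>The term \<open>i = 0\<close> alone is positive and the others are nonnegative. For the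
  upper bound, \<open>(2 * n - i) choose n\<close> is largest at \<open>i = 0\<close>, and what is
  left is the expansion of \<open>(1 + (N - 1)) ^ n\<close>.\<close>

lemma pade_num_bounds:
  fixes N \<nu> :: real
  assumes N: "N > 1" and \<nu>: "0 \<le> \<nu>" "\<nu> \<le> 1"
  shows "0 < pade_num n \<nu> N" "pade_num n \<nu> N \<le> real (2 * n choose n) * N ^ n"
proof -
  have "0 < (\<Sum>i\<in>{0}. ((real n - \<nu>) gchoose i) * real ((2 * n - i) choose n) * (N - 1) ^ (n - i))"
    using N by simp
  also have "\<dots> \<le> pade_num n \<nu> N"
    unfolding pade_num_def using N gbinomial_le_binomial[OF \<nu>]
    by (intro sum_mono2) auto
  finally show "0 < pade_num n \<nu> N" .
  have "pade_num n \<nu> N \<le> (\<Sum>i\<le>n. real (n choose i) * real (2 * n choose n) * (N - 1) ^ (n - i))"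
    unfolding pade_num_def using N gbinomial_le_binomial[OF \<nu>]
    by (intro sum_mono mult_mono) (auto intro!: binomial_right_mono)
  also have "\<dots> = real (2 * n choose n) * (1 + (N - 1)) ^ n"
    by (subst binomial_ring) (simp add: sum_distrib_left mult_ac)
  finally show "pade_num n \<nu> N \<le> real (2 * n choose n) * N ^ n" by simp
qed

section \<open>The gap principle\<close>

lemma pade_integral:
  fixes k n :: nat and N :: real
  assumes "k > 0" "N \<in> \<int>"
  shows "real k ^ (2 * n - 1) * pade_num n (1 / real k) N \<in> \<int>"
    and "real k ^ (2 * n - 1) * pade_den n (1 / real k) N \<in> \<int>"
proof -
  have "real k ^ (2 * n - 1) * (((real n - 1 / real k) gchoose i) * real ((2 * n - i) choose n) * (N - 1) ^ (n - i)) \<in> \<int>"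
    if "i \<le> n" for i
    using assms(2) unfolding mult.assoc[symmetric]
    by (intro Ints_mult[OF Ints_mult[OF gbinomial_denominator]] that assms(1)) auto
  then show "real k ^ (2 * n - 1) * pade_num n (1 / real k) N \<in> \<int>"
    unfolding pade_num_def sum_distrib_left by (intro Ints_sum) auto
  have "real k ^ (2 * n - 1) * ((-1) ^ i * ((real n - 1 / real k) gchoose i) * real ((2 * n - i) choose n) * N ^ (n - i)) \<in> \<int>"
    if "i \<le> n" for i
  proof -
    have "(real k ^ (2 * n - 1) * ((real n - 1 / real k) gchoose i)) * ((-1) ^ i * real ((2 * n - i) choose n) * N ^ (n - i)) \<in> \<int>"
      using assms(2) by (intro Ints_mult[OF gbinomial_denominator] that assms(1)) auto
    then show ?thesis by (simp only: mult_ac)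
  qed
  then show "real k ^ (2 * n - 1) * pade_den n (1 / real k) N \<in> \<int>"
    unfolding pade_den_def sum_distrib_left by (intro Ints_sum) auto
qed

text \<open>A mean value estimate, used to pass from a small difference of \<open>k\<close>-th
  powers to a small difference of their bases.\<close>

lemma power_diff_ge:
  fixes V W :: real
  assumes "0 \<le> W" "W \<le> V"
  shows "real (Suc m) * W ^ m * (V - W) \<le> V ^ Suc m - W ^ Suc m"
proof (induction m)
  case 0
  then show ?case by simp
next
  case (Suc m)
  have "real (Suc (Suc m)) * W ^ Suc m * (V - W) = W * (real (Suc m) * W ^ m * (V - W)) + W ^ Suc m * (V - W)"
    by (simp add: algebra_simps)
  also have "\<dots> \<le> V * (V ^ Suc m - W ^ Suc m) + W ^ Suc m * (V - W)"
    using Suc assms by (intro add_right_mono mult_mono) auto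
  also have "\<dots> = V ^ Suc (Suc m) - W ^ Suc (Suc m)"
    by (simp add: algebra_simps)
  finally show ?case .
qed

text \<open>The exponent \<open>2 * n - 1\<close> is truncated: it is \<open>0\<close> for \<open>n = 0\<close>.\<close>

lemma pade_gap:
  fixes k x y X A n :: nat
  defines "N \<equiv> real x ^ k"
  assumes k: "k > 0" and xy: "1 < x" "x < y" and X: "X > 0"
    and A: "0 < A" "real A < N - 1"
    and eq: "real X ^ k = (N - 1) * (real y ^ k - 1) + real A"
  shows "1 \<le> real k ^ (2 * n - 1) * (real (2 * n choose n) * N ^ n * (real x / (real k * real y ^ (k - 1)))
              + real x * real y / (real k * 4 ^ n * (N - 1) ^ (n + 1)))"
proof -
  define \<theta> where "\<theta> = (N / (N - 1)) powr (1 / real k)"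
  define V where "V = real x * real y"
  define W where "W = real X * \<theta>"
  \<comment> \<open>This is \<open>V ^ k - W ^ k\<close>; it is positive because
    \<open>A < N - 1\<close>.\<close>
  define \<epsilon> where "\<epsilon> = N - real A * N / (N - 1)"
  have N: "N > 1" using A by simp
  have "\<theta> ^ k = \<theta> powr real k"
    using N by (simp add: powr_realpow \<theta>_def)
  also have "\<dots> = N / (N - 1)"
    using N k by (simp add: \<theta>_def powr_powr)
  finally have \<theta>k: "\<theta> ^ k = N / (N - 1)" .
  have \<theta>1: "\<theta> \<ge> 1"
    unfolding \<theta>_def using N by (intro ge_one_powr_ge_zero) auto
  have W0: "W > 0"
    using X \<theta>1 by (simp add: W_def)
  have "W ^ k = real X ^ k * (N / (N - 1))"
    by (simp add: W_def power_mult_distrib \<theta>k)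
  also have "\<dots> = N * real y ^ k - \<epsilon>"
    unfolding eq \<epsilon>_def using N by (simp add: field_simps)
  also have "N * real y ^ k = V ^ k"
    by (simp add: V_def N_def power_mult_distrib)
  finally have Wk: "W ^ k = V ^ k - \<epsilon>" .
  have "real A * N < (N - 1) * N"
    using A N by (intro mult_strict_right_mono) auto
  then have "\<epsilon> > 0"
    unfolding \<epsilon>_def using N by (simp add: field_simps)
  then have WV: "W < V"
    using Wk by (intro power_less_imp_less_base[of W k V]) (auto simp: V_def)
  \<comment> \<open>Together with \<open>k * W ^ (k - 1) * (V - W) \<le> \<epsilon>\<close> this
    gives \<open>k * (V - W) * y ^ k \<le> W \<le> V = x * y\<close>. It reduces to
    \<open>N - 1 \<le> A * (y ^ k + 1)\<close>, which follows from \<open>x < y\<close> and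
    \<open>A \<ge> 1\<close>.\<close>
  have \<epsilon>_le: "\<epsilon> * real y ^ k \<le> W ^ k"
  proof -
    have "N \<le> real y ^ k"
      unfolding N_def using xy by (intro power_mono) auto
    then have "N - 1 \<le> 1 * (real y ^ k + 1)" by simp
    also have "\<dots> \<le> real A * (real y ^ k + 1)"
      using A by (intro mult_right_mono) auto
    finally have "1 \<le> real A / (N - 1) * (real y ^ k + 1)"
      using N by (simp add: field_simps)
    then have "N * 1 \<le> N * (real A / (N - 1) * (real y ^ k + 1))"
      using N by (intro mult_left_mono) auto
    then have "\<epsilon> * (real y ^ k + 1) \<le> N * real y ^ k"
      unfolding \<epsilon>_def by (simp add: algebra_simps)
    then show ?thesis
      unfolding Wk V_def N_def by (simp add: algebra_simps power_mult_distrib)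
  qed
  obtain m where m: "k = Suc m" using k by (cases k) auto
  have "real k * W ^ m * (V - W) \<le> \<epsilon>"
    using power_diff_ge[of W V m] W0 WV Wk unfolding m by simp
  then have "real k * W ^ m * (V - W) * (W * real y ^ k) \<le> \<epsilon> * (W * real y ^ k)"
    using W0 by (intro mult_right_mono) auto
  also have "\<dots> = W * (\<epsilon> * real y ^ k)"
    by (simp only: mult_ac)
  also have "\<dots> \<le> V * W ^ k"
    using \<epsilon>_le WV W0 \<open>\<epsilon> > 0\<close> by (intro mult_mono) auto
  finally have "(real k * (V - W) * real y ^ k) * W ^ k \<le> V * W ^ k"
    unfolding m by (simp add: mult_ac)
  then have "real k * (V - W) * real y ^ k \<le> V"
    using W0 by (simp add: mult_le_cancel_right)
  then have "(real k * (V - W) * real y ^ m) * real y \<le> real x * real y"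
    by (simp add: m V_def mult_ac)
  then have "real k * (V - W) * real y ^ m \<le> real x"
    using xy by (simp add: mult_le_cancel_right)
  then have \<delta>: "V - W \<le> real x / (real k * real y ^ (k - 1))"
    using k xy by (subst pos_le_divide_eq) (auto simp: m mult_ac)

  define P where "P = pade_num n (1 / real k) N"
  define Q where "Q = pade_den n (1 / real k) N"
  define D where "D = real k ^ (2 * n - 1)"
  have \<nu>: "0 \<le> 1 / real k" "1 / real k \<le> 1"
    using k by auto
  note T = pade_remainder[OF N \<nu>, of n, folded P_def Q_def \<theta>_def]
  note P = pade_num_bounds[OF N \<nu>, of n, folded P_def]
  have D: "D > 0" using k by (simp add: D_def)
  have NZ: "N \<in> \<int>" by (simp add: N_def)
  have "(D * P) * V - (D * Q) * real X \<in> \<int>"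
    unfolding D_def P_def Q_def V_def
    by (intro Ints_diff Ints_mult pade_integral[unfolded mult.assoc] k NZ) auto
  \<comment> \<open>Inserting \<open>W = X * \<theta>\<close> separates the error of
    \<open>x * y\<close> against \<open>X * \<theta>\<close> from the error of the Pade
    approximation.\<close>
  moreover have "(D * P) * V - (D * Q) * real X = D * (P * (V - W) + (P * \<theta> - Q) * real X)"
    by (simp add: W_def algebra_simps)
  ultimately obtain t :: int where t: "D * (P * (V - W) + (P * \<theta> - Q) * real X) = real_of_int t"
    by (auto elim: Ints_cases)
  \<comment> \<open>Both summands have the same sign, so no non-vanishing argument is needed.\<close>
  have "0 < D * (P * (V - W) + (P * \<theta> - Q) * real X)"
    using D P T WV by (intro mult_pos_pos add_pos_nonneg) auto
  then have "t \<ge> 1" unfolding t by simp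
  then have "1 \<le> D * (P * (V - W) + (P * \<theta> - Q) * real X)"
    unfolding t by simp
  also have "\<dots> \<le> D * (real (2 * n choose n) * N ^ n * (real x / (real k * real y ^ (k - 1)))
              + (1 / real k / (4 ^ n * (N - 1) ^ (n + 1))) * V)"
  proof (intro mult_left_mono add_mono mult_mono)
    have "real X * 1 \<le> real X * \<theta>"
      using \<theta>1 by (intro mult_left_mono) auto
    then show "real X \<le> V" using WV by (simp add: W_def)
  qed (use D P T WV \<delta> N in auto)
  finally show ?thesis
    by (simp add: D_def V_def mult_ac)
qed

section \<open>Numerical inequalities and the induction on the order of approximation\<close>

lemma central_binomial_le: "2 * real (2 * Suc n choose Suc n) \<le> 4 ^ Suc n"
proof -
  have "2 * ((2 * Suc n) choose Suc n) \<le> 2 * 2 ^ Suc (2 * n)"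
  proof -
    \<comment> \<open>The two entries on the right are distinct members of row
      \<open>2 * n + 1\<close>, whose sum is \<open>2 ^ (2 * n + 1)\<close>. The factor
      \<open>2\<close> gained over \<open>4 ^ Suc n\<close> later yields the error bound
      \<open>1 / 2\<close>.\<close>
    have "(2 * Suc n) choose Suc n = ((2 * n + 1) choose n) + ((2 * n + 1) choose Suc n)"
      by simp
    also have "\<dots> = (\<Sum>i\<in>{n, Suc n}. (2 * n + 1) choose i)"
      by simp
    also have "\<dots> \<le> (\<Sum>i\<le>2 * n + 1. (2 * n + 1) choose i)"
      by (intro sum_mono2) auto
    also have "\<dots> = 2 ^ Suc (2 * n)"
      by (subst choose_row_sum) simp
    finally show ?thesis by simp
  qed
  also have "\<dots> = 4 ^ Suc n"
    by (simp add: power_mult)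
  finally have "real (2 * ((2 * Suc n) choose Suc n)) \<le> real (4 ^ Suc n)"
    by (simp only: of_nat_le_iff)
  then show ?thesis by simp
qed

lemma power4_le_power5: "k \<ge> 3 \<Longrightarrow> real k ^ 4 \<le> 5 ^ k"
proof (induction k rule: dec_induct)
  case base
  then show ?case by simp
next
  case (step k)
  have "(real k + 1) ^ 4 \<le> (4 / 3 * real k) ^ 4"
    using step by (intro power_mono) auto
  also have "\<dots> \<le> 5 * real k ^ 4"
    by (simp add: power_mult_distrib power_divide)
  also have "\<dots> \<le> 5 * 5 ^ k" using step by simp
  finally show ?case by (simp add: add.commute)
qed

text \<open>Raising the order by one multiplies the lower bound for \<open>y\<close> by
  \<open>4 * (N - 1) / k\<^sup>2\<close> and the size required of \<open>y ^ (k - 1)\<close> by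
  \<open>4 * k\<^sup>2 * N\<close>. For \<open>k \<ge> 4\<close> the cube suffices, as
  \<open>k ^ 4 \<le> N\<close>; for \<open>k = 3\<close> only the square is available, and
  \<open>N = 125\<close> would fail.\<close>

lemma pade_ratio_bound:
  fixes N :: real
  assumes k: "k \<ge> 3" and N: "5 ^ k \<le> N" "216 \<le> N"
  shows "4 * real k ^ 2 * N \<le> (4 * (N - 1) / real k ^ 2) ^ (k - 1)"
proof (cases "k = 3")
  case True
  \<comment> \<open>The second factor is chosen so that the product agrees with
    \<open>16 * (N - 1)\<^sup>2 - 2916 * N\<close> up to the constant term.\<close>
  have "0 \<le> (N - 216) * (16 * N + 508)"
    using N by (intro mult_nonneg_nonneg) auto
  then have "36 * N \<le> (4 * (N - 1) / 9) ^ 2"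
    using N by (simp add: power2_eq_square algebra_simps)
  then show ?thesis using True by simp
next
  case False
  then have k4: "k \<ge> 4" using k by simp
  have kN: "real k ^ 4 \<le> N"
    using power4_le_power5[OF k] N by simp
  have k2: "real k ^ 2 > 0" using k by simp
  define \<rho> where "\<rho> = 4 * (N - 1) / real k ^ 2"
  have "real k ^ 2 \<le> real k ^ 4" using k by (intro power_increasing) auto
  then have \<rho>1: "1 \<le> \<rho>"
    using kN N k2 by (simp add: \<rho>_def)
  have "(real k ^ 4) ^ 2 * N \<le> N ^ 2 * N"
    using kN N by (intro mult_right_mono power_mono) auto
  also have "\<dots> = N ^ 3" by (simp add: power3_eq_cube power2_eq_square)
  also have "\<dots> \<le> (2 * (N - 1)) ^ 3"
    using N by (intro power_mono) auto
  also have "\<dots> \<le> 16 * (N - 1) ^ 3"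
    unfolding power_mult_distrib using N by simp
  finally have "4 * ((real k ^ 4) ^ 2 * N) \<le> (4 * (N - 1)) ^ 3"
    unfolding power_mult_distrib by (simp add: mult_ac)
  moreover have "4 * ((real k ^ 4) ^ 2 * N) = 4 * real k ^ 2 * N * (real k ^ 2) ^ 3"
    by (simp flip: power_mult power_add)
  moreover have "0 < (real k ^ 2) ^ 3" using k2 by (rule zero_less_power)
  ultimately have "4 * real k ^ 2 * N \<le> \<rho> ^ 3"
    unfolding \<rho>_def power_divide by (simp only: pos_le_divide_eq)
  also have "\<dots> \<le> \<rho> ^ (k - 1)"
    using k4 \<rho>1 by (intro power_increasing) auto
  finally show ?thesis by (simp add: \<rho>_def)
qed

text \<open>In the application \<open>A = a ^ (2 * k)\<close> and \<open>X = a\<^sup>2 * z\<close>.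
  The bound \<open>5 \<le> x\<close> supplies \<open>5 ^ k \<le> N\<close>.\<close>

lemma no_near_power_product:
  fixes k x y X A :: nat
  defines "N \<equiv> real x ^ k"
  assumes k: "k \<ge> 3" and xy: "5 \<le> x" "x < y" and N: "216 \<le> N"
    and A: "0 < A" "real A < N - 1"
    and eq: "real X ^ k = (N - 1) * (real y ^ k - 1) + real A"
  shows False
proof -
  have X: "X > 0"
  proof (rule ccontr)
    assume "\<not> X > 0"
    then have "(N - 1) * (real y ^ k - 1) + real A = 0" using eq k by (simp add: power_0_left)
    moreover have "1 \<le> real y ^ k" using xy by (intro one_le_power) auto
    then have "0 \<le> (N - 1) * (real y ^ k - 1)" using N by (intro mult_nonneg_nonneg) auto
    ultimately show False using A by simp
  qed
  have N5: "5 ^ k \<le> N"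
    unfolding N_def using xy by (intro power_mono) auto
  define \<rho> where "\<rho> = 4 * (N - 1) / real k ^ 2"
  define M where "M = (N - 1) / real x"
  have pos: "real k > 0" "real x > 0" "real y > 0" "N - 1 > 0" "N > 0" "\<rho> > 0" "M > 0"
    using k xy N by (auto simp: \<rho>_def M_def)
  have gap: "1 \<le> real k ^ (2 * n - 1) * (real (2 * n choose n) * N ^ n * (real x / (real k * real y ^ (k - 1)))
              + real x * real y / (real k * 4 ^ n * (N - 1) ^ (n + 1)))" for n
    using pade_gap[of k x y X A n] k xy X A eq unfolding N_def by simp
  have \<rho>: "4 * real k ^ 2 * N \<le> \<rho> ^ (k - 1)"
    unfolding \<rho>_def by (rule pade_ratio_bound[OF k N5 N])

  \<comment> \<open>Here \<open>M\<close> is about \<open>x ^ (k - 1)\<close>, so the right side is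
    about \<open>x ^ ((k - 1)\<^sup>2)\<close> against \<open>x ^ (k + 1)\<close>; the exponents
    coincide for \<open>k = 3\<close>. The constants give \<open>3 / 4 * 3 * 8 / 9 = 2\<close>, and
    \<open>2 ^ (k - 1) \<ge> 4\<close>.\<close>
  have base: "4 * real x * N \<le> (3 / 4 * real k * M) ^ (k - 1)"
  proof -
    have "8 / 9 * N \<le> N - 1" using N by simp
    then have "8 / 9 * N / real x \<le> M"
      unfolding M_def using pos by (intro divide_right_mono) auto
    moreover have "N / real x = real x ^ (k - 1)"
      using pos k by (simp add: N_def power_diff)
    ultimately have "8 / 9 * real x ^ (k - 1) \<le> M" by simp
    then have "9 / 4 * (8 / 9 * real x ^ (k - 1)) \<le> 3 / 4 * real k * M"
      using pos k by (intro mult_mono) auto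
    then have "(2 * real x ^ (k - 1)) ^ (k - 1) \<le> (3 / 4 * real k * M) ^ (k - 1)"
      by (intro power_mono) auto
    moreover have "4 * real x * N \<le> (2 * real x ^ (k - 1)) ^ (k - 1)"
    proof -
      have "(2::real) ^ 2 \<le> 2 ^ (k - 1)"
        using k by (intro power_increasing) auto
      moreover have "real x ^ (k + 1) \<le> real x ^ ((k - 1) * (k - 1))"
      proof (rule power_increasing)
        obtain j where "k = j + 3" using k by (metis add.commute le_Suc_ex)
        then show "k + 1 \<le> (k - 1) * (k - 1)" by simp
      qed (use xy in auto)
      ultimately have "2 ^ 2 * real x ^ (k + 1) \<le> 2 ^ (k - 1) * real x ^ ((k - 1) * (k - 1))"
        by (intro mult_mono) auto
      then show ?thesis by (simp add: N_def power_mult_distrib power_mult)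
    qed
    ultimately show ?thesis by simp
  qed

  \<comment> \<open>Order \<open>0\<close> starts the induction: the first error term is at most
    \<open>1 / 4\<close>, so the remainder term is at least \<open>3 / 4\<close>.\<close>
  have y0: "3 / 4 * real k * M \<le> real y"
  proof -
    have "4 * real x \<le> real k * real y ^ (k - 1)"
    proof -
      have "real x \<le> real y ^ 1" using xy by simp
      also have "\<dots> \<le> real y ^ (k - 2)"
        using xy k by (intro power_increasing) auto
      finally have "3 * (2 * real x) \<le> real k * (real y * real y ^ (k - 2))"
        using k xy by (intro mult_mono) auto
      moreover have "real y * real y ^ (k - 2) = real y ^ (k - 1)"
      proof -
        have "k - 1 = Suc (k - 2)" using k by simp
        then show ?thesis by simp
      qed
      ultimately have "6 * real x \<le> real k * real y ^ (k - 1)" by simp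
      then show ?thesis using pos by linarith
    qed
    then have "real x / (real k * real y ^ (k - 1)) \<le> 1 / 4"
      using pos by (simp add: divide_le_eq)
    moreover have "1 \<le> real x / (real k * real y ^ (k - 1)) + real x * real y / (real k * (N - 1))"
      using gap[of 0] by simp
    ultimately have "3 / 4 \<le> real x * real y / (real k * (N - 1))" by linarith
    then show ?thesis
      using pos by (simp add: M_def field_simps)
  qed

  \<comment> \<open>The hypothesis makes the first error term at order \<open>Suc n\<close> at most
    \<open>1 / 2\<close>; the remainder term must then be at least \<open>1 / 2\<close>, which is
    solved for \<open>y\<close>.\<close>
  have step: "real k ^ 2 / 2 * M * \<rho> ^ Suc n \<le> real y"
    if y: "4 * real x * N * (4 * real k ^ 2 * N) ^ n \<le> real y ^ (k - 1)" for n
  proof -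
    define c where "c = real k ^ (2 * Suc n - 1) * (real (2 * Suc n choose Suc n) * N ^ Suc n)"
    have kp: "real k ^ (2 * Suc n - 1) * real k = (real k ^ 2) ^ Suc n"
      by (simp flip: power_mult add: mult_ac) (simp add: power2_eq_square)
    have "2 * (c * real x) * real k = (real k ^ (2 * Suc n - 1) * real k) * N ^ Suc n * real x * (2 * real (2 * Suc n choose Suc n))"
      by (simp only: c_def mult_ac)
    also have "\<dots> \<le> (real k ^ (2 * Suc n - 1) * real k) * N ^ Suc n * real x * 4 ^ Suc n"
      using pos by (intro mult_left_mono central_binomial_le) auto
    also have "\<dots> = real x * (4 * real k ^ 2 * N) ^ Suc n"
      unfolding kp by (simp only: power_mult_distrib mult_ac)
    also have "\<dots> = (4 * real x * N * (4 * real k ^ 2 * N) ^ n) * real k ^ 2"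
      by (simp add: mult_ac)
    also have "\<dots> \<le> real y ^ (k - 1) * real k ^ 2"
      using y by (intro mult_right_mono) auto
    finally have "2 * (c * real x) * real k \<le> (real y ^ (k - 1) * real k) * real k"
      by (simp add: power2_eq_square mult_ac)
    then have "c * real x \<le> real y ^ (k - 1) * real k / 2"
      using pos by (simp add: mult_le_cancel_right)
    then have "c * (real x / (real k * real y ^ (k - 1))) \<le> 1 / 2"
      using pos by (simp add: field_simps)
    then have "1 / 2 \<le> real k ^ (2 * Suc n - 1) * (real x * real y / (real k * 4 ^ Suc n * (N - 1) ^ (Suc n + 1)))"
      using gap[of "Suc n"] unfolding c_def distrib_left by (simp only: mult.assoc)
    moreover have "0 < real k * 4 ^ Suc n * (N - 1) ^ (Suc n + 1)"
      using pos by (intro mult_pos_pos zero_less_power) auto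
    ultimately have "1 / 2 * (real k * 4 ^ Suc n * (N - 1) ^ (Suc n + 1)) \<le> real k ^ (2 * Suc n - 1) * (real x * real y)"
      by (simp only: times_divide_eq_right pos_le_divide_eq)
    then have "(1 / 2 * (real k * 4 ^ Suc n * (N - 1) ^ (Suc n + 1))) * real k
        \<le> (real k ^ (2 * Suc n - 1) * (real x * real y)) * real k"
      using pos by (intro mult_right_mono) auto
    then have "1 / 2 * (4 ^ Suc n * (N - 1) ^ (Suc n + 1)) * real k * real k \<le> (real k ^ (2 * Suc n - 1) * real k) * (real x * real y)"
      by (simp only: mult_ac)
    then have "1 / 2 * (4 * (N - 1)) ^ Suc n * (N - 1) * real k ^ 2 \<le> (real k ^ 2) ^ Suc n * (real x * real y)"
      unfolding kp power_mult_distrib[of 4 "N - 1"]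
      by (simp only: power_Suc power_add power_one_right power2_eq_square mult_ac)
    then have "(1 / 2 * (4 * (N - 1)) ^ Suc n * (N - 1) * real k ^ 2) / (real k ^ 2) ^ Suc n \<le> real x * real y"
      using pos by (subst pos_divide_le_eq) (auto simp: mult_ac)
    then have "1 / 2 * ((4 * (N - 1)) ^ Suc n / (real k ^ 2) ^ Suc n) * (N - 1) * real k ^ 2 \<le> real x * real y"
      by (simp only: times_divide_eq_left times_divide_eq_right)
    then have "1 / 2 * \<rho> ^ Suc n * (N - 1) * real k ^ 2 \<le> real x * real y"
      by (simp only: \<rho>_def power_divide)
    then show ?thesis
      using pos by (simp add: M_def field_simps)
  qed

  have grow: "4 * real x * N * (4 * real k ^ 2 * N) ^ n \<le> real y ^ (k - 1)" for n
  proof (induction n)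
    case 0
    have "(3 / 4 * real k * M) ^ (k - 1) \<le> real y ^ (k - 1)"
      using y0 pos by (intro power_mono) auto
    then show ?case using base by simp
  next
    case (Suc n)
    \<comment> \<open>Since \<open>k\<^sup>2 / 2 \<ge> 3 / 4 * k\<close>, the bound from
      \<open>step\<close> still dominates \<open>base\<close>; the extra
      \<open>\<rho> ^ Suc n\<close> pays for \<open>(4 * k\<^sup>2 * N) ^ Suc n\<close>.\<close>
    have "real k * (3 / 4) \<le> real k * (real k / 2)"
      using k by (intro mult_left_mono) auto
    then have "(3 / 4 * real k) * M \<le> (real k ^ 2 / 2) * M"
      using pos by (intro mult_right_mono) (auto simp: power2_eq_square)
    then have "(3 / 4 * real k * M) ^ (k - 1) \<le> (real k ^ 2 / 2 * M) ^ (k - 1)"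
      using pos by (intro power_mono) auto
    then have "4 * real x * N * (4 * real k ^ 2 * N) ^ Suc n \<le> (real k ^ 2 / 2 * M) ^ (k - 1) * (\<rho> ^ (k - 1)) ^ Suc n"
      using base \<rho> pos by (intro mult_mono power_mono) auto
    also have "\<dots> = (real k ^ 2 / 2 * M * \<rho> ^ Suc n) ^ (k - 1)"
      by (simp only: power_mult_distrib mult.commute flip: power_mult)
    also have "\<dots> \<le> real y ^ (k - 1)"
      using step[OF Suc] pos by (intro power_mono) auto
    finally show ?case .
  qed

  have "1 < 4 * real k ^ 2 * N"
  proof -
    have "1 * 1 \<le> real k ^ 2 * N" using k N by (intro mult_mono) auto
    then show ?thesis by simp
  qed
  then obtain n where "real y ^ (k - 1) < (4 * real k ^ 2 * N) ^ n"
    using real_arch_pow by blast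
  also have "\<dots> \<le> 4 * real x * N * (4 * real k ^ 2 * N) ^ n"
  proof -
    have "1 * 1 \<le> 4 * real x * N" using xy N by (intro mult_mono) auto
    then show ?thesis
      using pos mult_right_mono[of 1 "4 * real x * N" "(4 * real k ^ 2 * N) ^ n"] by simp
  qed
  finally show False using grow[of n] by simp
qed

section \<open>Reduction of the theorem to the gap principle\<close>

lemma is_kth_powerE:
  assumes "is_kth_power k n" "0 \<le> n"
  obtains x :: nat where "n = int x ^ k"
proof -
  obtain x :: int where "n = x ^ k" using assms(1) by (auto simp: is_kth_power_def)
  then have "n = int (nat \<bar>x\<bar>) ^ k"
    using assms(2) by (simp add: power_abs[symmetric])
  then show ?thesis by (rule that)
qed

theorem theorem1p1:
  fixes k :: nat and a b c :: int
  assumes "k \<ge> 3" and "1 < a" and "a < b" and "b < c" and "a ^ k < b"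
  shows "\<not> (is_kth_power k (a ^ k * b + 1) \<and> is_kth_power k (a ^ k * c + 1)
              \<and> is_kth_power k (b * c + 1))"
proof
  assume H: "is_kth_power k (a ^ k * b + 1) \<and> is_kth_power k (a ^ k * c + 1)
              \<and> is_kth_power k (b * c + 1)"
  have ak: "a ^ k > 0" using assms by simp
  have b: "b > 0" and c: "c > 0" using assms by auto
  obtain x where x: "a ^ k * b + 1 = int x ^ k"
    using H ak b by (auto elim!: is_kth_powerE)
  obtain y where y: "a ^ k * c + 1 = int y ^ k"
    using H ak c by (auto elim!: is_kth_powerE)
  obtain z where z: "b * c + 1 = int z ^ k"
    using H b c by (auto elim!: is_kth_powerE)
  define a' where "a' = nat a"
  have a': "a = int a'" "2 \<le> a'" using assms by (auto simp: a'_def)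
  have "int x ^ k < int y ^ k"
    unfolding x[symmetric] y[symmetric] using mult_strict_left_mono[OF assms(4) ak] by simp
  then have xy: "x < y"
    using power_less_imp_less_base[of "int x" k "int y"] by simp
  have "(a ^ 2) ^ k = a ^ k * a ^ k"
    by (simp add: power2_eq_square power_mult_distrib)
  also have "\<dots> < a ^ k * b" using assms(5) ak by (rule mult_strict_left_mono)
  finally have A: "(a ^ 2) ^ k < int x ^ k - 1" using x by simp
  then have "a ^ 2 < int x"
    by (intro power_less_imp_less_base[of "a ^ 2" k "int x"]) auto
  then have ax: "a' ^ 2 < x" unfolding a' by (simp flip: of_nat_power)
  have "2 ^ 2 \<le> a' ^ 2" using a' by (intro power_mono) auto
  then have x5: "5 \<le> x" using ax by simp
  \<comment> \<open>Given \<open>x \<ge> 5\<close> and \<open>k \<ge> 3\<close>, the only smaller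
    value is \<open>5 ^ 3 = 125\<close>. There \<open>a\<^sup>2 < 5\<close> forces
    \<open>a = 2\<close>, and \<open>8 * b = 124\<close> has no integer solution.\<close>
  have "216 \<le> x ^ k"
  proof (cases "x = 5 \<and> k = 3")
    case True
    then have "a' ^ 2 < 3 ^ 2" using ax by simp
    then have "a' < 3" by (rule power_less_imp_less_base) simp
    then have "a = 2" using a' by simp
    then have "8 * b + 1 = 125" using x True by simp
    then show ?thesis by presburger
  next
    case False
    show ?thesis
    proof (cases "x = 5")
      case True
      have "(5::nat) ^ 4 \<le> 5 ^ k"
        using True False \<open>k \<ge> 3\<close> by (intro power_increasing) auto
      then show ?thesis using True by simp
    next
      case False
      have "6 ^ 3 \<le> (6::nat) ^ k" using \<open>k \<ge> 3\<close> by (intro power_increasing) auto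
      also have "\<dots> \<le> x ^ k" using False x5 by (intro power_mono) auto
      finally show ?thesis by simp
    qed
  qed
  then have N: "216 \<le> real x ^ k"
    by (simp flip: of_nat_power)
  \<comment> \<open>Multiplying \<open>b * c + 1\<close> by \<open>a ^ (2 * k)\<close> keeps it a
    \<open>k\<close>-th power and eliminates \<open>b\<close> and \<open>c\<close> in favour of
    \<open>x\<close> and \<open>y\<close>.\<close>
  have "(a ^ 2 * int z) ^ k = (a ^ k * a ^ k) * (b * c + 1)"
    unfolding z by (simp add: power_mult_distrib power2_eq_square)
  also have "\<dots> = (a ^ k * b) * (a ^ k * c) + (a ^ 2) ^ k"
    by (simp add: algebra_simps power2_eq_square power_mult_distrib)
  also have "\<dots> = (int x ^ k - 1) * (int y ^ k - 1) + (a ^ 2) ^ k"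
    unfolding x[symmetric] y[symmetric] by simp
  finally have eq: "int (a' ^ 2 * z) ^ k = (int x ^ k - 1) * (int y ^ k - 1) + int ((a' ^ 2) ^ k)"
    by (simp add: a')
  have "real (a' ^ 2 * z) ^ k = (real x ^ k - 1) * (real y ^ k - 1) + real ((a' ^ 2) ^ k)"
    using arg_cong[OF eq, of real_of_int] by simp
  moreover have "real ((a' ^ 2) ^ k) < real x ^ k - 1"
  proof -
    have "real_of_int ((a ^ 2) ^ k) < real_of_int (int x ^ k - 1)"
      using A by (simp only: of_int_less_iff)
    then show ?thesis by (simp add: a')
  qed
  moreover have "0 < (a' ^ 2) ^ k" using a' by simp
  ultimately show False
    using no_near_power_product[of k x y "(a' ^ 2) ^ k" "a' ^ 2 * z"] N xy x5 \<open>k \<ge> 3\<close> by blast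
qed

end
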